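(* Let $p$ be an odd prime. Let $\omega_D,\omega_Q\in H^3(V_3,k^\times)\cong\bigwedge^3(x_0,x_1,x_2)\oplus\mathsf{S}^2(z_0,z_1,z_2)$ be the classes $$\omega_D=(x_0\wedge x_1\wedge x_2,\;0),\qquad\omega_Q=(x_0\wedge x_1\wedge x_2,\;z_0z_1).$$ Then $$\mathsf{Stab}(\omega_D)=SL_3(\mathbb{F}_p)\qquad\text{and}\qquad\mathsf{Stab}(\omega_Q)\cong AffO_2(\mathbb{F}_p).$$
   Context: $k$ is an algebraically closed field of characteristic $0$. $V_3$ is the elementary abelian $p$-group of order $p^3$, viewed as a vector space over $\mathbb{F}_p$ with coordinate functions $x_0,x_1,x_2$ forming a basis of $V_3^*=\mathrm{Hom}(V_3,\mathbb{F}_p)$; $z_0,z_1,z_2$ denotes the same basis of $V_3^*$ when used for the symmetric algebra. The isomorphism $H^3(V_3,k^\times)\cong\bigwedge^3(V_3^* )\oplus\mathsf{S}^2(V_3^* )$ is one of $GL_3(\mathbb{F}_p)$-modules: with $\xi\in k$ a fixed primitive $p$-th root of unity, $x_i\wedge x_j\wedge x_l$ corresponds to the class of $(u,v,w)\mapsto\xi^{u_iv_jw_l}$, and $z_iz_j$ to the class of $(u,v,w)\mapsto\xi^{u_iy_j(v,w)}$, where $y_j(v,w)=0$ if $v_j+w_j<p$ and $1$ if $v_j+w_j\ge p$ ($v_j,w_j\in\{0,\dots,p-1\}$ added as integers). (These classes arise from the extra special groups $D,Q$ of order $p^3$ and exponents $p$, $p^2$.) $\mathsf{Stab}(\omega)\subset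 GL_3(\mathbb{F}_p)$ is the subgroup of automorphisms $a$ of $V_3$ such that $\omega\circ(a\times a\times a)$ is cohomologous to $\omega$. For a subgroup $G\subset GL(V)$, $AffG=V\rtimes G$ is the corresponding affine group; $O_2(\mathbb{F}_p)$ is the orthogonal group of the (split) quadratic form $z_0z_1$ on $\mathbb{F}_p^2$, and $AffO_2(\mathbb{F}_p)=\mathbb{F}_p^2\rtimes O_2(\mathbb{F}_p)$. *)

theory Defs
  imports
    "HOL-Analysis.Analysis"
    "HOL-Algebra.Coset"
    "Berlekamp_Zassenhaus.Finite_Field"
begin

section \<open>Matrix groups and affine groups\<close>

definition GL :: "('a::comm_ring_1 ^ 'n ^ 'n) monoid" where
  "GL = \<lparr>carrier = {A. invertible A}, mult = (**), one = mat 1\<rparr>"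

definition SL :: "('a::comm_ring_1 ^ 'n ^ 'n) set" where
  "SL = {A \<in> carrier GL. det A = 1}"

text \<open>The semidirect product of the translations with a set \<open>G\<close> of matrices (in applications a
  subgroup of \<^const>\<open>GL\<close>): the pair \<open>(a, A)\<close> stands for the affine map \<open>x \<mapsto> a + A x\<close>.\<close>

definition affine_group ::
    "('a::comm_ring_1 ^ 'n ^ 'n) set \<Rightarrow> (('a ^ 'n) \<times> ('a ^ 'n ^ 'n)) monoid" where
  "affine_group G =
     \<lparr>carrier = UNIV \<times> G,
      mult = (\<lambda>(a, A) (b, B). (a + A *v b, A ** B)),
      one = (0, mat 1)\<rparr>"

text \<open>The numeral index type \<^typ>\<open>2\<close> has elements \<open>0, 1\<close>, and \<^typ>\<open>3\<close> has elements \<open>0, 1, 2\<close>.\<close>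

definition split_form :: "'a::comm_ring_1 ^ 2 \<Rightarrow> 'a" where
  "split_form u = u $ 0 * u $ 1"

definition O2 :: "('a::comm_ring_1 ^ 2 ^ 2) set" where
  "O2 = {A \<in> carrier GL. \<forall>u. split_form (A *v u) = split_form u}"

section \<open>Third cohomology of an abelian group with coefficients in \<open>k\<^sup>\<times>\<close>\<close>

text \<open>Inhomogeneous cochains for the trivial action, written multiplicatively; \<open>k\<^sup>\<times>\<close> is the set
  of non-zero elements of the field \<open>k\<close>.\<close>

type_synonym ('v, 'k) cochain2 = "'v \<Rightarrow> 'v \<Rightarrow> 'k"
type_synonym ('v, 'k) cochain3 = "'v \<Rightarrow> 'v \<Rightarrow> 'v \<Rightarrow> 'k"

definition coboundary2 ::
    "('v::ab_group_add, 'k::field) cochain2 \<Rightarrow> ('v, 'k) cochain3" where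
  "coboundary2 g = (\<lambda>u v w. (g v w * g u (v + w)) / (g (u + v) w * g u v))"

definition coboundary3 ::
    "('v::ab_group_add, 'k::field) cochain3 \<Rightarrow> 'v \<Rightarrow> 'v \<Rightarrow> 'v \<Rightarrow> 'v \<Rightarrow> 'k" where
  "coboundary3 f =
     (\<lambda>t u v w. (f u v w * f t (u + v) w * f t u v) / (f (t + u) v w * f t u (v + w)))"

definition cocycles3 :: "('v::ab_group_add, 'k::field) cochain3 monoid" where
  "cocycles3 =
     \<lparr>carrier = {f. (\<forall>u v w. f u v w \<noteq> 0) \<and> (\<forall>t u v w. coboundary3 f t u v w = 1)},
      mult = (\<lambda>f g u v w. f u v w * g u v w),
      one = (\<lambda>u v w. 1)\<rparr>"

definition coboundaries3 :: "('v::ab_group_add, 'k::field) cochain3 set" where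
  "coboundaries3 = {coboundary2 g | g. \<forall>u v. g u v \<noteq> 0}"

definition H3 :: "('v::ab_group_add, 'k::field) cochain3 set monoid" where
  "H3 = cocycles3 Mod coboundaries3"

definition cohomology_class ::
    "('v::ab_group_add, 'k::field) cochain3 \<Rightarrow> ('v, 'k) cochain3 set" where
  "cohomology_class f = coboundaries3 #>\<^bsub>cocycles3\<^esub> f"

definition cohomologous ::
    "('v::ab_group_add, 'k::field) cochain3 \<Rightarrow> ('v, 'k) cochain3 \<Rightarrow> bool" where
  "cohomologous f g \<longleftrightarrow> cohomology_class f = cohomology_class g"

definition pullback3 :: "('v \<Rightarrow> 'v) \<Rightarrow> ('v, 'k) cochain3 \<Rightarrow> ('v, 'k) cochain3" where
  "pullback3 a f = (\<lambda>u v w. f (a u) (a v) (a w))"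

text \<open>The stabilizer of a class \<open>\<omega> \<in> H\<^sup>3(V, k\<^sup>\<times>)\<close>; the condition does not depend on the
  representing cocycle \<open>f\<close>, see \<open>Stab_cohomology_class\<close> below.\<close>

definition Stab ::
    "('a::comm_ring_1 ^ 'n, 'k::field) cochain3 set \<Rightarrow> ('a ^ 'n ^ 'n) set" where
  "Stab \<omega> = {A \<in> carrier GL. \<forall>f\<in>\<omega>. cohomologous (pullback3 ((*v) A) f) f}"

section \<open>The classes on \<open>V\<^sub>3 = F\<^sub>p\<^sup>3\<close>\<close>

text \<open>The field with \<open>p\<close> elements is \<^typ>\<open>'p mod_ring\<close> with \<open>p = CARD('p)\<close>; the class
  \<^class>\<open>prime_card\<close> says that \<open>p\<close> is prime. The function \<^const>\<open>to_int_mod_ring\<close> chooses the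
  representative in \<open>{0..<p}\<close>.\<close>

definition primitive_root_of_unity :: "nat \<Rightarrow> 'k::field \<Rightarrow> bool" where
  "primitive_root_of_unity n \<xi> \<longleftrightarrow> \<xi> ^ n = 1 \<and> (\<forall>m. 0 < m \<and> m < n \<longrightarrow> \<xi> ^ m \<noteq> 1)"

definition char_pow :: "'k::field \<Rightarrow> 'p::prime_card mod_ring \<Rightarrow> 'k" where
  "char_pow \<xi> x = \<xi> ^ nat (to_int_mod_ring x)"

definition carry :: "'p::prime_card mod_ring \<Rightarrow> 'p mod_ring \<Rightarrow> 'p mod_ring" where
  "carry x y = (if to_int_mod_ring x + to_int_mod_ring y < int CARD('p) then 0 else 1)"

definition wedge_cocycle ::
    "'k::field \<Rightarrow> 3 \<Rightarrow> 3 \<Rightarrow> 3 \<Rightarrow> ('p::prime_card mod_ring ^ 3, 'k) cochain3" where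
  "wedge_cocycle \<xi> i j l = (\<lambda>u v w. char_pow \<xi> (u $ i * v $ j * w $ l))"

definition sym_cocycle ::
    "'k::field \<Rightarrow> 3 \<Rightarrow> 3 \<Rightarrow> ('p::prime_card mod_ring ^ 3, 'k) cochain3" where
  "sym_cocycle \<xi> i j = (\<lambda>u v w. char_pow \<xi> (u $ i * carry (v $ j) (w $ j)))"

text \<open>The classes of \<open>x\<^sub>i \<and> x\<^sub>j \<and> x\<^sub>l\<close> and of \<open>z\<^sub>i z\<^sub>j\<close>.\<close>

definition wedge_class ::
    "'k::field \<Rightarrow> 3 \<Rightarrow> 3 \<Rightarrow> 3 \<Rightarrow> ('p::prime_card mod_ring ^ 3, 'k) cochain3 set" where
  "wedge_class \<xi> i j l = cohomology_class (wedge_cocycle \<xi> i j l)"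

definition sym_class ::
    "'k::field \<Rightarrow> 3 \<Rightarrow> 3 \<Rightarrow> ('p::prime_card mod_ring ^ 3, 'k) cochain3 set" where
  "sym_class \<xi> i j = cohomology_class (sym_cocycle \<xi> i j)"

text \<open>A pair \<open>(\<lambda>, s)\<close> of the direct sum is the product of the two classes in \<^const>\<open>H3\<close>, whose
  operation is multiplicative.\<close>

definition omega_D :: "'k::field \<Rightarrow> ('p::prime_card mod_ring ^ 3, 'k) cochain3 set" where
  "omega_D \<xi> = wedge_class \<xi> 0 1 2 \<otimes>\<^bsub>H3\<^esub> \<one>\<^bsub>H3\<^esub>"

definition omega_Q :: "'k::field \<Rightarrow> ('p::prime_card mod_ring ^ 3, 'k) cochain3 set" where
  "omega_Q \<xi> = wedge_class \<xi> 0 1 2 \<otimes>\<^bsub>H3\<^esub> sym_class \<xi> 0 1"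

section \<open>Well-definedness\<close>

lemma group_GL: "group (GL :: ('a::comm_ring_1 ^ 'n ^ 'n) monoid)"
proof (rule groupI)
  fix A :: "'a ^ 'n ^ 'n" assume "A \<in> carrier GL"
  then obtain B where "A ** B = mat 1" "B ** A = mat 1"
    by (auto simp: GL_def invertible_def)
  then show "\<exists>B\<in>carrier GL. B \<otimes>\<^bsub>GL\<^esub> A = \<one>\<^bsub>GL\<^esub>"
    by (intro bexI[of _ B]) (auto simp: GL_def invertible_def)
qed (auto simp: GL_def invertible_mult matrix_mul_assoc, auto simp: invertible_def)

lemma comm_group_cocycles3:
  "comm_group (cocycles3 :: ('v::ab_group_add, 'k::field) cochain3 monoid)"
proof (rule comm_groupI)
  fix f :: "('v, 'k) cochain3" assume f: "f \<in> carrier cocycles3"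
  have "(\<lambda>u v w. inverse (f u v w)) \<in> carrier cocycles3"
  proof -
    have "coboundary3 (\<lambda>u v w. inverse (f u v w)) t u v w = inverse (coboundary3 f t u v w)"
      for t u v w
      by (simp add: coboundary3_def divide_inverse mult_ac)
    with f show ?thesis by (simp add: cocycles3_def)
  qed
  moreover have "(\<lambda>u v w. inverse (f u v w)) \<otimes>\<^bsub>cocycles3\<^esub> f = \<one>\<^bsub>cocycles3\<^esub>"
    using f by (auto simp: cocycles3_def fun_eq_iff)
  ultimately show "\<exists>g\<in>carrier cocycles3. g \<otimes>\<^bsub>cocycles3\<^esub> f = \<one>\<^bsub>cocycles3\<^esub>"
    by blast
next
  fix f g :: "('v, 'k) cochain3"
  assume fg: "f \<in> carrier cocycles3" "g \<in> carrier cocycles3"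
  have "coboundary3 (\<lambda>u v w. f u v w * g u v w) t u v w
      = coboundary3 f t u v w * coboundary3 g t u v w" for t u v w
    by (simp add: coboundary3_def divide_inverse mult_ac)
  with fg show "f \<otimes>\<^bsub>cocycles3\<^esub> g \<in> carrier cocycles3"
    by (simp add: cocycles3_def)
next
  show "\<one>\<^bsub>cocycles3\<^esub> \<in> carrier (cocycles3 :: ('v, 'k) cochain3 monoid)"
    by (simp add: cocycles3_def coboundary3_def)
qed (simp_all add: cocycles3_def mult_ac)

lemma coboundaries3_subset:
  "(coboundaries3 :: ('v::ab_group_add, 'k::field) cochain3 set) \<subseteq> carrier cocycles3"
proof
  fix f :: "('v, 'k) cochain3" assume "f \<in> coboundaries3"
  then obtain g where g: "\<And>u v. g u v \<noteq> 0" and f: "f = coboundary2 g"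
    by (auto simp: coboundaries3_def)
  have "coboundary3 f t u v w = 1" for t u v w
    unfolding f coboundary3_def coboundary2_def add.assoc by (simp add: g)
  moreover have "f u v w \<noteq> 0" for u v w
    by (simp add: f coboundary2_def g)
  ultimately show "f \<in> carrier cocycles3"
    by (simp add: cocycles3_def)
qed

lemma subgroup_coboundaries3:
  "subgroup (coboundaries3 :: ('v::ab_group_add, 'k::field) cochain3 set) cocycles3"
proof -
  interpret comm_group "cocycles3 :: ('v, 'k) cochain3 monoid"
    by (rule comm_group_cocycles3)
  show ?thesis
  proof (rule subgroupI[OF coboundaries3_subset])
    have "coboundary2 (\<lambda>_ _. 1) \<in> (coboundaries3 :: ('v, 'k) cochain3 set)"
      unfolding coboundaries3_def by force
    then show "(coboundaries3 :: ('v, 'k) cochain3 set) \<noteq> {}" by blast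
  next
    fix f :: "('v, 'k) cochain3" assume "f \<in> coboundaries3"
    then obtain g where g: "\<forall>u v. g u v \<noteq> 0" "f = coboundary2 g"
      by (auto simp: coboundaries3_def)
    let ?h = "coboundary2 (\<lambda>u v. inverse (g u v)) :: ('v, 'k) cochain3"
    have "\<forall>u v. inverse (g u v) \<noteq> 0"
      using g(1) by simp
    then have h: "?h \<in> coboundaries3"
      unfolding coboundaries3_def by blast
    have "?h \<otimes>\<^bsub>cocycles3\<^esub> f = \<one>\<^bsub>cocycles3\<^esub>"
      using g(1) by (simp add: g(2) coboundary2_def cocycles3_def fun_eq_iff field_simps)
    then have "inv\<^bsub>cocycles3\<^esub> f = ?h"
      using h g coboundaries3_subset \<open>f \<in> coboundaries3\<close> by (intro inv_equality) auto
    with h show "inv\<^bsub>cocycles3\<^esub> f \<in> coboundaries3" by simp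
  next
    fix f f' :: "('v, 'k) cochain3" assume "f \<in> coboundaries3" "f' \<in> coboundaries3"
    then obtain g g' where g: "\<forall>u v. g u v \<noteq> 0" "f = coboundary2 g"
      "\<forall>u v. g' u v \<noteq> 0" "f' = coboundary2 g'"
      by (auto simp: coboundaries3_def)
    have "f \<otimes>\<^bsub>cocycles3\<^esub> f' = coboundary2 (\<lambda>u v. g u v * g' u v)"
      by (simp add: g coboundary2_def cocycles3_def divide_inverse mult_ac)
    moreover have "\<forall>u v. g u v * g' u v \<noteq> 0"
      using g(1,3) by simp
    ultimately show "f \<otimes>\<^bsub>cocycles3\<^esub> f' \<in> coboundaries3"
      unfolding coboundaries3_def by blast
  qed
qed

lemma normal_coboundaries3:
  "(coboundaries3 :: ('v::ab_group_add, 'k::field) cochain3 set) \<lhd> cocycles3"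
  using comm_group.normal_iff_subgroup[OF comm_group_cocycles3] subgroup_coboundaries3 by blast

lemma group_H3: "group (H3 :: ('v::ab_group_add, 'k::field) cochain3 set monoid)"
  unfolding H3_def by (rule normal.factorgroup_is_group[OF normal_coboundaries3])

lemma char_pow_add:
  assumes "\<xi> ^ CARD('p) = 1"
  shows "char_pow \<xi> (x + y :: 'p::prime_card mod_ring) = char_pow \<xi> x * char_pow \<xi> y"
proof -
  have pow: "\<xi> ^ (n mod CARD('p)) = \<xi> ^ n" for n
  proof -
    have "\<xi> ^ n = \<xi> ^ (CARD('p) * (n div CARD('p)) + n mod CARD('p))" by simp
    also have "\<dots> = \<xi> ^ (n mod CARD('p))"
      using assms by (simp only: power_add power_mult power_one mult_1_left)
    finally show ?thesis by simp
  qed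
  have nn: "0 \<le> to_int_mod_ring z" for z :: "'p mod_ring" by transfer simp
  have "to_int_mod_ring (x + y) = (to_int_mod_ring x + to_int_mod_ring y) mod int CARD('p)"
    by transfer simp
  then have "nat (to_int_mod_ring (x + y))
      = (nat (to_int_mod_ring x) + nat (to_int_mod_ring y)) mod CARD('p)"
    using nn[of x] nn[of y] by (simp add: nat_mod_distrib nat_add_distrib)
  then show ?thesis
    by (simp add: char_pow_def pow power_add)
qed

lemma char_pow_nonzero:
  assumes "\<xi> ^ CARD('p) = (1::'k::field)"
  shows "char_pow \<xi> (x :: 'p::prime_card mod_ring) \<noteq> 0"
  using assms by (auto simp: char_pow_def power_0_left)

lemma carry_cocycle:
  "carry y z + carry x (y + z) = carry (x + y) z + carry (x :: 'p::prime_card mod_ring) y"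
proof -
  let ?n = "\<lambda>x::'p mod_ring. to_int_mod_ring x" and ?p = "int CARD('p)"
  have bnd: "0 \<le> ?n x" "?n x < ?p" for x by (transfer; simp)+
  have add: "?n (x + y) = (if ?n x + ?n y < ?p then ?n x + ?n y else ?n x + ?n y - ?p)" for x y
  proof -
    have eq: "?n (x + y) = (?n x + ?n y) mod ?p" by transfer simp
    show ?thesis
    proof (cases "?n x + ?n y < ?p")
      case True
      then show ?thesis using bnd[of x] bnd[of y] eq by (simp add: mod_pos_pos_trivial)
    next
      case False
      have "(?n x + ?n y) mod ?p = (?n x + ?n y - ?p) mod ?p" by simp
      also have "\<dots> = ?n x + ?n y - ?p"
        using False bnd[of x] bnd[of y] by (intro mod_pos_pos_trivial) auto
      finally show ?thesis using False eq by simp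
    qed
  qed
  show ?thesis
    unfolding carry_def add using bnd[of x] bnd[of y] bnd[of z] by auto
qed

lemma cocycles3I_char_pow:
  assumes "\<xi> ^ CARD('p) = (1::'k::field)"
    and "\<And>t u v w. F u v w + F t (u + v) w + F t u v = F (t + u) v w + F t u (v + w)"
  shows "(\<lambda>u v w. char_pow \<xi> (F u v w :: 'p::prime_card mod_ring))
    \<in> carrier (cocycles3 :: ('v::ab_group_add, 'k) cochain3 monoid)"
  using assms char_pow_nonzero[OF assms(1)]
  by (simp add: cocycles3_def coboundary3_def char_pow_add[OF assms(1), symmetric])

lemma wedge_cocycle_in_cocycles3:
  assumes "primitive_root_of_unity CARD('p) (\<xi> :: 'k::field)"
  shows "(wedge_cocycle \<xi> i j l :: ('p::prime_card mod_ring ^ 3, 'k) cochain3) \<in> carrier cocycles3"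
  unfolding wedge_cocycle_def using assms
  by (intro cocycles3I_char_pow) (auto simp: primitive_root_of_unity_def algebra_simps)

lemma sym_cocycle_in_cocycles3:
  assumes "primitive_root_of_unity CARD('p) (\<xi> :: 'k::field)"
  shows "(sym_cocycle \<xi> i j :: ('p::prime_card mod_ring ^ 3, 'k) cochain3) \<in> carrier cocycles3"
  unfolding sym_cocycle_def
proof (intro cocycles3I_char_pow)
  fix t u v w :: "'p mod_ring ^ 3"
  have "u $ i * carry (v $ j) (w $ j) + t $ i * carry (u $ j + v $ j) (w $ j)
      + t $ i * carry (u $ j) (v $ j)
    = u $ i * carry (v $ j) (w $ j)
      + t $ i * (carry (u $ j + v $ j) (w $ j) + carry (u $ j) (v $ j))"
    by (simp add: algebra_simps)
  also have "\<dots> = (t $ i + u $ i) * carry (v $ j) (w $ j)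
      + t $ i * carry (u $ j) (v $ j + w $ j)"
    unfolding carry_cocycle[symmetric] by (simp add: algebra_simps)
  finally show "u $ i * carry (v $ j) (w $ j) + t $ i * carry ((u + v) $ j) (w $ j)
      + t $ i * carry (u $ j) (v $ j)
    = (t + u) $ i * carry (v $ j) (w $ j) + t $ i * carry (u $ j) ((v + w) $ j)"
    by simp
qed (use assms in \<open>auto simp: primitive_root_of_unity_def\<close>)

lemma cohomology_class_in_H3:
  "f \<in> carrier cocycles3 \<Longrightarrow> cohomology_class f \<in> carrier H3"
  by (auto simp: H3_def FactGroup_def RCOSETS_def cohomology_class_def)

lemma mem_cohomology_class:
  "f \<in> cohomology_class f"
  if "f \<in> carrier (cocycles3 :: ('v::ab_group_add, 'k::field) cochain3 monoid)"
  unfolding cohomology_class_def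
  using group.rcos_self[OF _ that subgroup_coboundaries3] comm_group_cocycles3
  by (auto simp: comm_group_def)

lemma pullback3_cohomology_class:
  fixes f f' :: "('a::comm_ring_1 ^ 'n, 'k::field) cochain3"
  assumes "f \<in> carrier cocycles3" "f' \<in> cohomology_class f"
  shows "pullback3 ((*v) A) f' \<in> cohomology_class (pullback3 ((*v) A) f)"
proof -
  obtain g where g: "\<forall>u v. g u v \<noteq> 0" "f' = (\<lambda>u v w. coboundary2 g u v w * f u v w)"
    using assms by (auto simp: cohomology_class_def r_coset_def coboundaries3_def cocycles3_def)
  have "pullback3 ((*v) A) f' = coboundary2 (\<lambda>u v. g (A *v u) (A *v v))
      \<otimes>\<^bsub>cocycles3\<^esub> pullback3 ((*v) A) f"
    by (simp add: g pullback3_def coboundary2_def cocycles3_def matrix_vector_right_distrib)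
  moreover have "coboundary2 (\<lambda>u v. g (A *v u) (A *v v)) \<in> coboundaries3"
    unfolding coboundaries3_def using g(1) by blast
  ultimately show ?thesis
    unfolding cohomology_class_def r_coset_def by blast
qed

lemma pullback3_in_cocycles3:
  fixes f :: "('a::comm_ring_1 ^ 'n, 'k::field) cochain3"
  assumes "f \<in> carrier cocycles3"
  shows "pullback3 ((*v) A) f \<in> carrier cocycles3"
  using assms by (simp add: cocycles3_def pullback3_def coboundary3_def matrix_vector_right_distrib)

lemma cohomology_class_eq:
  fixes f f' :: "('v::ab_group_add, 'k::field) cochain3"
  assumes "f \<in> carrier cocycles3" "f' \<in> cohomology_class f"
  shows "cohomology_class f' = cohomology_class f"
  using group.repr_independence[OF _ assms(2)[unfolded cohomology_class_def] assms(1)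
      subgroup_coboundaries3] comm_group_cocycles3
  by (auto simp: cohomology_class_def comm_group_def)

lemma Stab_cohomology_class:
  fixes f :: "('a::comm_ring_1 ^ 'n, 'k::field) cochain3"
  assumes "f \<in> carrier cocycles3"
  shows "Stab (cohomology_class f) = {A \<in> carrier GL. cohomologous (pullback3 ((*v) A) f) f}"
proof -
  have "cohomologous (pullback3 ((*v) A) f') f' \<longleftrightarrow> cohomologous (pullback3 ((*v) A) f) f"
    if "f' \<in> cohomology_class f" for f' and A :: "'a ^ 'n ^ 'n"
    using cohomology_class_eq[OF assms that]
      cohomology_class_eq[OF pullback3_in_cocycles3[OF assms] pullback3_cohomology_class[OF assms that]]
    by (simp add: cohomologous_def)
  with mem_cohomology_class[OF assms] show ?thesis
    unfolding Stab_def by blast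
qed

end

theory Submission
  imports Defs
begin

text \<open>Two invariants of a 3-cocycle \<open>f\<close> are trivial on coboundaries: its antisymmetrization, and the
  product of \<open>f u (m u) u\<close> over \<open>0 \<le> m < p\<close>, which telescopes. On \<open>\<omega>\<^sub>Q\<close> they take the values \<open>\<xi>\<close> to
  the power \<open>det (u, v, w)\<close> and \<open>\<xi>\<close> to the power \<open>u\<^sub>0 u\<^sub>1\<close>, since adding up \<open>p\<close> copies of \<open>u\<^sub>1\<close> produces
  \<open>u\<^sub>1\<close> carries and \<open>p\<close> divides \<open>0 + 1 + \<dots> + (p - 1)\<close>. Hence the stabilizer preserves the determinant
  and the form \<open>z\<^sub>0 z\<^sub>1\<close>. Conversely, explicit cochains show that \<open>u\<^sub>i v\<^sub>j w\<^sub>l\<close> is alternating and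
  \<open>u\<^sub>i carry (v\<^sub>j, w\<^sub>j)\<close> is symmetric bilinear modulo coboundaries. A matrix of determinant 1
  preserving \<open>z\<^sub>0 z\<^sub>1\<close> has the rows \<open>(B, 0)\<close> and \<open>(r, det B)\<close> with \<open>B \<in> O\<^sub>2\<close>, and \<open>r B\<^sup>-\<^sup>1\<close> is the
  translation vector rotated by a quarter turn.\<close>

section \<open>Arithmetic of carries\<close>

lemma UNIV_2_from_0: "(UNIV::2 set) = {0, 1}"
  by (auto simp: UNIV_2)

lemma UNIV_3_from_0: "(UNIV::3 set) = {0, 1, 2}"
proof -
  have "(3::3) = 0" by simp
  then show ?thesis unfolding UNIV_3 by auto
qed

lemma sum_2_from_0: "sum f (UNIV::2 set) = f 0 + f 1"
  by (simp add: UNIV_2_from_0)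

lemma sum_3_from_0: "sum f (UNIV::3 set) = f 0 + f 1 + f 2"
  unfolding UNIV_3_from_0 by (simp add: ac_simps)

lemma det_2_from_0: "det (A::'a::comm_ring_1^2^2) = A$0$0 * A$1$1 - A$0$1 * A$1$0"
proof -
  have "(2::2) = 0" by simp
  show ?thesis unfolding det_2 \<open>2 = 0\<close> by (simp add: algebra_simps)
qed

lemma det_3_from_0:
  "det (A::'a::comm_ring_1^3^3) =
    A$0$0 * (A$1$1 * A$2$2 - A$1$2 * A$2$1) - A$0$1 * (A$1$0 * A$2$2 - A$1$2 * A$2$0)
    + A$0$2 * (A$1$0 * A$2$1 - A$1$1 * A$2$0)"
proof -
  have "(3::3) = 0" by simp
  show ?thesis unfolding det_3 \<open>3 = 0\<close> by (simp add: algebra_simps)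
qed

lemma matrix_vector_mult_2: "(A *v u) $ i = A$i$0 * u$0 + A$i$1 * u$1"
  for A :: "'a::comm_ring_1 ^ 2 ^ 'n"
  by (simp add: matrix_vector_mult_def sum_2_from_0)

lemma matrix_vector_mult_3: "(A *v u) $ i = A$i$0 * u$0 + A$i$1 * u$1 + A$i$2 * u$2"
  for A :: "'a::comm_ring_1 ^ 3 ^ 'n"
  by (simp add: matrix_vector_mult_def sum_3_from_0)

lemma to_int_mod_ring_bounds:
  "0 \<le> to_int_mod_ring x" "to_int_mod_ring x < int CARD('p)" for x :: "'p::prime_card mod_ring"
  by (transfer; simp)+

section \<open>Roots of unity with exponents in F_p\<close>

lemma char_pow_diff:
  assumes "\<xi> ^ CARD('p) = (1::'k::field)"
  shows "char_pow \<xi> (x - y :: 'p::prime_card mod_ring) = char_pow \<xi> x / char_pow \<xi> y"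
  using char_pow_add[OF assms, of "x - y" y] char_pow_nonzero[OF assms, of y] by simp

lemma char_pow_0: "char_pow \<xi> (0 :: 'p::prime_card mod_ring) = 1"
  by (simp add: char_pow_def)

lemma char_pow_sum:
  assumes "\<xi> ^ CARD('p) = (1::'k::field)"
  shows "char_pow \<xi> (\<Sum>x\<in>X. f x :: 'p::prime_card mod_ring) = (\<Prod>x\<in>X. char_pow \<xi> (f x))"
  by (induction X rule: infinite_finite_induct) (simp_all add: char_pow_0 char_pow_add[OF assms])

lemma char_pow_eq_1_iff:
  assumes "primitive_root_of_unity CARD('p) (\<xi>::'k::field)"
  shows "char_pow \<xi> (x :: 'p::prime_card mod_ring) = 1 \<longleftrightarrow> x = 0"
proof
  assume "char_pow \<xi> x = 1"
  moreover have "nat (to_int_mod_ring x) < CARD('p)"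
    using to_int_mod_ring_bounds[of x] by auto
  ultimately have "nat (to_int_mod_ring x) = 0"
    using assms unfolding char_pow_def primitive_root_of_unity_def by (metis gr0I)
  then have "to_int_mod_ring x = 0"
    using to_int_mod_ring_bounds[of x] by auto
  then show "x = 0"
    by (metis of_int_mod_ring_to_int_mod_ring of_int_mod_ring_hom.hom_zero)
qed (simp add: char_pow_0)

lemma char_pow_of_nat:
  assumes "\<xi> ^ CARD('p) = (1::'k::field)"
  shows "char_pow \<xi> (of_nat n :: 'p::prime_card mod_ring) = \<xi> ^ n"
proof (induction n)
  case (Suc n)
  have "char_pow \<xi> (1 :: 'p mod_ring) = \<xi>"
    by (simp add: char_pow_def)
  with Suc show ?case by (simp add: char_pow_add[OF assms])
qed (simp add: char_pow_0)

lemma of_int_to_int_mod_ring: "of_int (to_int_mod_ring x) = (x :: 'p::nontriv mod_ring)"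
  by (simp add: of_int_of_int_mod_ring)

text \<open>The natural number \<open>c\<close> behind a carry is the additivity defect of the
  integer representatives divided by p. Identities between carries can therefore be proved over the
  integers.\<close>

lemma carry_eq_of_nat:
  obtains c :: nat where "carry x y = (of_nat c :: 'p::prime_card mod_ring)"
    and "int CARD('p) * int c = to_int_mod_ring x + to_int_mod_ring y - to_int_mod_ring (x + y)"
proof -
  let ?n = "to_int_mod_ring :: 'p mod_ring \<Rightarrow> int" and ?p = "int CARD('p)"
  note bnd = to_int_mod_ring_bounds[where 'p = 'p]
  have eq: "?n (x + y) = (?n x + ?n y) mod ?p" by transfer simp
  show thesis
  proof (cases "?n x + ?n y < ?p")
    case True
    then show thesis
      using bnd[of x] bnd[of y] eq by (intro that[of 0]) (simp_all add: carry_def)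
  next
    case False
    have "(?n x + ?n y) mod ?p = (?n x + ?n y - ?p) mod ?p" by simp
    also have "\<dots> = ?n x + ?n y - ?p"
      using False bnd[of x] bnd[of y] by (intro mod_pos_pos_trivial) auto
    finally show thesis
      using False eq by (intro that[of 1]) (simp_all add: carry_def)
  qed
qed

text \<open>The factor p has to be cancelled over the integers; the reduction modulo p comes
  afterwards.\<close>

lemma sum_of_int_carry:
  fixes f :: "'i \<Rightarrow> int" and x y :: "'i \<Rightarrow> 'p::prime_card mod_ring"
  assumes "(\<Sum>i\<in>I. f i * (to_int_mod_ring (x i) + to_int_mod_ring (y i) - to_int_mod_ring (x i + y i)))
    = int CARD('p) * d"
  shows "(\<Sum>i\<in>I. of_int (f i) * carry (x i) (y i)) = of_int d"
proof -
  have "\<forall>i. \<exists>c. carry (x i) (y i) = (of_nat c :: 'p mod_ring) \<and> int CARD('p) * int c =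
      to_int_mod_ring (x i) + to_int_mod_ring (y i) - to_int_mod_ring (x i + y i)"
    using carry_eq_of_nat by metis
  then obtain c where c: "\<And>i. carry (x i) (y i) = of_nat (c i)"
    "\<And>i. int CARD('p) * int (c i) =
      to_int_mod_ring (x i) + to_int_mod_ring (y i) - to_int_mod_ring (x i + y i)"
    by metis
  have "int CARD('p) * (\<Sum>i\<in>I. f i * int (c i)) = int CARD('p) * d"
    unfolding assms[symmetric] c(2)[symmetric] by (simp add: sum_distrib_left mult_ac)
  then have "(\<Sum>i\<in>I. f i * int (c i)) = d" by simp
  then show ?thesis by (simp add: c(1) flip: \<open>_ = d\<close>)
qed

lemma carry_commute: "carry x y = carry y x"
  by (simp add: carry_def add.commute)

text \<open>The carry of a linear form represents its Bockstein, which is additive up to a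
  coboundary. Combining the representatives of \<open>a i\<close> and \<open>x v i\<close> gives an
  integer lift of \<open>f v\<close>; it differs from the canonical representative by a multiple of
  p, and \<open>h v\<close> is the quotient modulo p.\<close>

lemma carry_linear_combination:
  fixes I :: "'i set" and a :: "'i \<Rightarrow> 'p::prime_card mod_ring" and x :: "'v::ab_group_add \<Rightarrow> 'i \<Rightarrow> 'p mod_ring"
  assumes x: "\<And>v w i. x (v + w) i = x v i + x w i"
  defines "f \<equiv> \<lambda>v. \<Sum>i\<in>I. a i * x v i"
  obtains h where "\<And>v w. (\<Sum>i\<in>I. a i * carry (x v i) (x w i))
    = carry (f v) (f w) + (h v + h w - h (v + w))"
proof -
  let ?n = "to_int_mod_ring :: 'p mod_ring \<Rightarrow> int" and ?p = "int CARD('p)"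
  have f_add: "f (v + w) = f v + f w" for v w
    by (simp add: f_def x distrib_left sum.distrib)
  have "\<exists>d. (\<Sum>i\<in>I. ?n (a i) * ?n (x v i)) = ?n (f v) + ?p * d" for v
  proof -
    have "(of_int ((\<Sum>i\<in>I. ?n (a i) * ?n (x v i)) - ?n (f v)) :: 'p mod_ring) = 0"
      by (simp add: of_int_to_int_mod_ring f_def)
    then have "?p dvd (\<Sum>i\<in>I. ?n (a i) * ?n (x v i)) - ?n (f v)"
      unfolding of_int_eq_0_iff_char_dvd semiring_char_mod_ring .
    then show ?thesis by (metis diff_add_cancel add.commute dvdE)
  qed
  then obtain d where d: "\<And>v. (\<Sum>i\<in>I. ?n (a i) * ?n (x v i)) = ?n (f v) + ?p * d v"
    by metis
  have "(\<Sum>i\<in>I. a i * carry (x v i) (x w i))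
    = carry (f v) (f w) + (of_int (d v) + of_int (d w) - of_int (d (v + w)))" for v w
  proof -
    obtain c where c: "carry (f v) (f w) = (of_nat c :: 'p mod_ring)"
      "?p * int c = ?n (f v) + ?n (f w) - ?n (f v + f w)"
      by (rule carry_eq_of_nat)
    have "(\<Sum>i\<in>I. ?n (a i) * (?n (x v i) + ?n (x w i) - ?n (x v i + x w i)))
      = (\<Sum>i\<in>I. ?n (a i) * ?n (x v i)) + (\<Sum>i\<in>I. ?n (a i) * ?n (x w i))
        - (\<Sum>i\<in>I. ?n (a i) * ?n (x (v + w) i))"
      by (simp add: x algebra_simps sum.distrib sum_subtractf)
    also have "\<dots> = ?p * (int c + (d v + d w - d (v + w)))"
      unfolding d f_add distrib_left c(2) by (simp add: algebra_simps)
    finally have "(\<Sum>i\<in>I. of_int (?n (a i)) * carry (x v i) (x w i))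
      = (of_int (int c + (d v + d w - d (v + w))) :: 'p mod_ring)"
      by (rule sum_of_int_carry)
    then show ?thesis by (simp add: of_int_to_int_mod_ring c(1))
  qed
  then show thesis by (rule that)
qed

text \<open>The representatives of the multiples of \<open>x\<close> telescope and contribute
  nothing, since p times \<open>x\<close> is 0. What is left is p times the representative of
  \<open>x\<close>.\<close>

lemma sum_carry_multiples:
  "(\<Sum>m<CARD('p). carry (of_nat m * x) x) = (x :: 'p::prime_card mod_ring)"
proof -
  let ?n = "to_int_mod_ring :: 'p mod_ring \<Rightarrow> int"
  have "(\<Sum>m<CARD('p). 1 * (?n (of_nat m * x) + ?n x - ?n (of_nat m * x + x)))
      = (\<Sum>m<CARD('p). ?n x) - (\<Sum>m<CARD('p). ?n (of_nat (Suc m) * x) - ?n (of_nat m * x))"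
    unfolding sum_subtractf[symmetric] by (simp add: algebra_simps)
  also have "\<dots> = int CARD('p) * ?n x"
    using sum_lessThan_telescope[of "\<lambda>m. ?n (of_nat m * x)"] by simp
  finally have "(\<Sum>m<CARD('p). of_int 1 * carry (of_nat m * x) x) = of_int (?n x)"
    by (rule sum_of_int_carry)
  then show ?thesis by (simp add: of_int_to_int_mod_ring)
qed

lemma sum_of_nat_mod_ring_eq_0:
  assumes "odd CARD('p::prime_card)"
  shows "(\<Sum>m<CARD('p). of_nat m) = (0 :: 'p mod_ring)"
proof -
  obtain k where k: "CARD('p) = 2 * k + 1" using assms by (elim oddE)
  have "2 * (\<Sum>m<n. m) + n = n * n" for n :: nat
    by (induction n) auto
  then have "2 * (\<Sum>m<CARD('p). m) + CARD('p) = CARD('p) * CARD('p)" .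
  then have "2 * (\<Sum>m<CARD('p). m) = 2 * (CARD('p) * k)"
    by (simp add: k algebra_simps)
  then have "(\<Sum>m<CARD('p). m) = CARD('p) * k" by simp
  then have "(of_nat (\<Sum>m<CARD('p). m) :: 'p mod_ring) = of_nat (CARD('p) * k)" by metis
  then show ?thesis by simp
qed

lemma two_neq_0_mod_ring:
  assumes "odd CARD('p::prime_card)"
  shows "(2 :: 'p mod_ring) \<noteq> 0"
proof
  assume "(2 :: 'p mod_ring) = 0"
  then have "CARD('p) dvd 2" using of_nat_0_mod_ring_dvd[of 2, where 'a = 'p] by simp
  moreover have "1 < CARD('p)" by (metis nontriv)
  ultimately have "CARD('p) = 2" by (metis One_nat_def Suc_1 Suc_leI dvd_imp_le le_antisym pos2)
  with assms show False by simp
qed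

section \<open>Exponents of coboundaries\<close>

text \<open>Cochains with values in the p-th roots of unity become additive functions into F_p. The
  bounding cochain may still take any non-zero values in the field, so this is weaker than being a
  coboundary over F_p.\<close>

definition null_exponent ::
    "'k::field \<Rightarrow> ('v::ab_group_add \<Rightarrow> 'v \<Rightarrow> 'v \<Rightarrow> 'p::prime_card mod_ring) \<Rightarrow> bool" where
  "null_exponent \<xi> F \<longleftrightarrow> (\<lambda>u v w. char_pow \<xi> (F u v w)) \<in> coboundaries3"

section \<open>Invariants that are trivial on coboundaries\<close>

lemma coboundaries3_mult:
  assumes "f \<in> coboundaries3" "g \<in> coboundaries3"
  shows "(\<lambda>u v w. f u v w * g u v w) \<in> coboundaries3"
  using subgroup.m_closed[OF subgroup_coboundaries3 assms] by (simp add: cocycles3_def)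

lemma coboundaries3_one: "(\<lambda>u v w. 1) \<in> coboundaries3"
  using subgroup.one_closed[OF subgroup_coboundaries3] by (simp add: cocycles3_def)

text \<open>In the product over cyclic rotations the factors \<open>g x y\<close>,
  \<open>g y z\<close>, \<open>g z x\<close> cancel. Addition being commutative, the remaining
  quotient is invariant under all permutations of the arguments.\<close>

lemma coboundaries3_alternating:
  assumes "f \<in> coboundaries3"
  shows "f u v w * f v w u * f w u v = f v u w * f u w v * f w v u"
proof -
  obtain g where g: "\<And>u v. g u v \<noteq> 0" "f = coboundary2 g"
    using assms by (auto simp: coboundaries3_def)
  have "f x y z * f y z x * f z x y = (g x (y + z) * g y (z + x) * g z (x + y))
      / (g (x + y) z * g (y + z) x * g (z + x) y)" for x y z
    unfolding g(2) coboundary2_def using g(1) by (simp add: divide_simps mult_ac)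
  from this[of u v w] this[of v u w] show ?thesis
    by (simp only: add.commute mult_ac)
qed

lemma coboundaries3_prod_cyclic:
  assumes "f \<in> coboundaries3" and "\<And>m. s (Suc m) = s m + u" and "s n = s 0"
  shows "(\<Prod>m<n. f u (s m) u) = 1"
proof -
  obtain g where g: "\<And>u v. g u v \<noteq> 0" "f = coboundary2 g"
    using assms by (auto simp: coboundaries3_def)
  \<comment> \<open>\<open>?a m\<close> compares the two orders of the arguments of
    \<open>g\<close>. As \<open>u + s m = s (Suc m)\<close>, the factor \<open>f u (s m) u\<close>
    is the quotient of two successive values.\<close>
  let ?a = "\<lambda>m. g u (s m) / g (s m) u"
  have "(\<Prod>m<n. f u (s m) u) = (\<Prod>m<n. ?a (Suc m) / ?a m)"
    unfolding g(2) coboundary2_def assms(2)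
    by (intro prod.cong refl) (simp only: add.commute[of u] divide_divide_eq_left divide_divide_eq_right times_divide_eq_left times_divide_eq_right mult_ac)
  also have "\<dots> = ?a n / ?a 0"
    by (rule prod_lessThan_telescope) (simp add: g(1))
  finally show ?thesis by (simp add: assms(3) g(1))
qed

context
  fixes \<xi> :: "'k::field"
  assumes \<xi>: "primitive_root_of_unity CARD('p::prime_card) \<xi>"
begin

lemma root_pow_card: "\<xi> ^ CARD('p) = 1"
  using \<xi> by (simp add: primitive_root_of_unity_def)

section \<open>Null exponents form a vector space over F_p\<close>

lemma null_exponent_0:
  "null_exponent \<xi> (\<lambda>u v w. 0 :: 'p mod_ring)"
  by (simp add: null_exponent_def char_pow_0 coboundaries3_one)

lemma null_exponent_add:
  assumes "null_exponent \<xi> F" "null_exponent \<xi> G"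
  shows "null_exponent \<xi> (\<lambda>u v w. F u v w + G u v w :: 'p mod_ring)"
  using coboundaries3_mult[OF assms[unfolded null_exponent_def]]
  by (simp add: null_exponent_def char_pow_add[OF root_pow_card])

lemma null_exponent_scale:
  assumes "null_exponent \<xi> F"
  shows "null_exponent \<xi> (\<lambda>u v w. c * F u v w :: 'p mod_ring)"
proof -
  \<comment> \<open>A scalar in F_p is a sum of ones, so closure under addition suffices.\<close>
  obtain n where c: "c = of_nat n"
    using surj_of_nat_mod_ring[of c] by blast
  show ?thesis
    unfolding c
    by (induction n) (simp_all add: null_exponent_0 distrib_right null_exponent_add[OF assms])
qed

lemma null_exponent_diff:
  assumes "null_exponent \<xi> F" "null_exponent \<xi> G"
  shows "null_exponent \<xi> (\<lambda>u v w. F u v w - G u v w :: 'p mod_ring)"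
  using null_exponent_add[OF assms(1) null_exponent_scale[OF assms(2), of "- 1"]] by simp

lemma null_exponent_sum:
  assumes "\<And>i. i \<in> I \<Longrightarrow> null_exponent \<xi> (F i)"
  shows "null_exponent \<xi> (\<lambda>u v w. \<Sum>i\<in>I. F i u v w :: 'p mod_ring)"
  using assms
  by (induction I rule: infinite_finite_induct) (simp_all add: null_exponent_0 null_exponent_add)

lemma null_exponent_coboundary:
  "null_exponent \<xi> (\<lambda>u v w. G v w - G (u + v) w + G u (v + w) - G u v :: 'p mod_ring)"
proof -
  have "(\<lambda>u v w. char_pow \<xi> (G v w - G (u + v) w + G u (v + w) - G u v))
      = coboundary2 (\<lambda>u v. char_pow \<xi> (G u v))"
    using char_pow_nonzero[OF root_pow_card]
    by (simp add: fun_eq_iff coboundary2_def char_pow_add[OF root_pow_card]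
        char_pow_diff[OF root_pow_card] field_simps)
  then show ?thesis
    unfolding null_exponent_def coboundaries3_def using char_pow_nonzero[OF root_pow_card] by auto
qed

lemma null_exponent_alternating:
  assumes "null_exponent \<xi> F"
  shows "F u v w + F v w u + F w u v = (F v u w + F u w v + F w v u :: 'p mod_ring)"
proof -
  have "char_pow \<xi> (F u v w + F v w u + F w u v - (F v u w + F u w v + F w v u)) = 1"
    using coboundaries3_alternating[OF assms[unfolded null_exponent_def], of u v w]
      char_pow_nonzero[OF root_pow_card]
    by (simp add: char_pow_add[OF root_pow_card] char_pow_diff[OF root_pow_card])
  then show ?thesis by (simp add: char_pow_eq_1_iff[OF \<xi>])
qed

lemma null_exponent_sum_cyclic:
  fixes u :: "'p mod_ring ^ 'n"
  assumes "null_exponent \<xi> F"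
  shows "(\<Sum>m<CARD('p). F u (of_nat m *s u) u) = (0 :: 'p mod_ring)"
proof -
  have "char_pow \<xi> (\<Sum>m<CARD('p). F u (of_nat m *s u) u) = 1"
    unfolding char_pow_sum[OF root_pow_card]
    \<comment> \<open>Here \<open>s m\<close> is m times \<open>u\<close>, which returns to 0 after
      p steps.\<close>
    by (rule coboundaries3_prod_cyclic[OF assms[unfolded null_exponent_def]])
      (simp_all add: vec_eq_iff algebra_simps)
  then show ?thesis by (simp add: char_pow_eq_1_iff[OF \<xi>])
qed

section \<open>Explicit cochains bounding the symmetry relations\<close>

lemma null_exponent_symmetrize_right:
  fixes f g h :: "'v::ab_group_add \<Rightarrow> 'p mod_ring"
  assumes "\<And>x y. g (x + y) = g x + g y" "\<And>x y. h (x + y) = h x + h y"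
    "\<And>x y. f (x + y) = f x + f y"
  shows "null_exponent \<xi> (\<lambda>u v w. f u * g v * h w + f u * h v * g w)"
proof -
  \<comment> \<open>The cross terms are the polarization of the quadratic function
    \<open>g v * h v\<close>, whence the bounding cochain \<open>f u * g v * h v\<close>.\<close>
  have "f u * g v * h w + f u * h v * g w
    = f v * g w * h w - f (u + v) * g w * h w + f u * g (v + w) * h (v + w) - f u * g v * h v"
    for u v w by (simp add: assms algebra_simps)
  then show ?thesis
    using null_exponent_coboundary[of "\<lambda>u v. f u * g v * h v"] by simp
qed

lemma null_exponent_symmetrize_left:
  fixes f g h :: "'v::ab_group_add \<Rightarrow> 'p mod_ring"
  assumes "\<And>x y. g (x + y) = g x + g y" "\<And>x y. h (x + y) = h x + h y"
    "\<And>x y. f (x + y) = f x + f y"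
  shows "null_exponent \<xi> (\<lambda>u v w. f u * g v * h w + g u * f v * h w)"
proof -
  have "f u * g v * h w + g u * f v * h w
    = - (f v * g v * h w) - - (f (u + v) * g (u + v) * h w) + - (f u * g u * h (v + w))
      - - (f u * g u * h v)"
    for u v w by (simp add: assms algebra_simps)
  then show ?thesis
    using null_exponent_coboundary[of "\<lambda>u v. - (f u * g u * h v)"] by simp
qed


text \<open>Commutativity of the cup product in degrees 1 and 2. In the coboundary of
  \<open>(f u + f v) * c u v\<close> every coefficient is \<open>f u + f v + f w\<close> up to one
  missing summand in the two outer terms. The common factor multiplies the cocycle identity of
  \<open>c\<close>, and the missing summands give the claim.\<close>

lemma null_exponent_cup_commute:
  fixes f :: "'v::ab_group_add \<Rightarrow> 'p mod_ring"
  assumes f: "\<And>x y. f (x + y) = f x + f y"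
    and c: "\<And>u v w. c v w + c u (v + w) = c (u + v) w + c u v"
  shows "null_exponent \<xi> (\<lambda>u v w. c u v * f w - f u * c v w)"
proof -
  have "c u v * f w - f u * c v w = (f v + f w) * c v w - (f (u + v) + f w) * c (u + v) w
      + (f u + f (v + w)) * c u (v + w) - (f u + f v) * c u v" for u v w
  proof -
    have eq: "c u (v + w) = c (u + v) w + c u v - c v w"
      using c[of v w u] by (simp add: algebra_simps)
    show ?thesis unfolding eq by (simp add: f algebra_simps)
  qed
  then show ?thesis
    using null_exponent_coboundary[of "\<lambda>u v. (f u + f v) * c u v"] by simp
qed

text \<open>Leibniz rule: the additive \<open>f\<close> is closed, so its product with a coboundary
  is again one, with a sign.\<close>

lemma null_exponent_cup_coboundary:
  fixes f :: "'v::ab_group_add \<Rightarrow> 'p mod_ring"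
  assumes "\<And>x y. f (x + y) = f x + f y"
  shows "null_exponent \<xi> (\<lambda>u v w. f u * (h v + h w - h (v + w)))"
proof -
  have "f u * (h v + h w - h (v + w))
    = - (f v * h w) - - (f (u + v) * h w) + - (f u * h (v + w)) - - (f u * h v)" for u v w
    by (simp add: assms algebra_simps)
  then show ?thesis
    using null_exponent_coboundary[of "\<lambda>u v. - (f u * h v)"] by simp
qed

end

text \<open>The class of \<open>x \<union> \<beta>(y) - \<beta>(x) \<union> y\<close>, with \<open>\<beta>\<close> the Bockstein, is non-zero over \<open>F\<^sub>p\<close> and vanishes
  only in \<open>k\<^sup>\<times>\<close>: the cochain exhibiting this takes values in the \<open>p\<^sup>2\<close>-th roots of unity.\<close>

lemma null_exponent_bockstein:
  fixes \<xi> :: "'k::alg_closed_field" and f g :: "'v::ab_group_add \<Rightarrow> 'p::prime_card mod_ring"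
  assumes \<xi>: "primitive_root_of_unity CARD('p) \<xi>"
    and f: "\<And>x y. f (x + y) = f x + f y" and g: "\<And>x y. g (x + y) = g x + g y"
  shows "null_exponent \<xi> (\<lambda>u v w. f u * carry (g v) (g w) - carry (f u) (f v) * g w)"
proof -
  note pow = root_pow_card[OF \<xi>]
  let ?N = "\<lambda>x :: 'p mod_ring. nat (to_int_mod_ring x)"
  have "0 < CARD('p)" by simp
  then obtain \<zeta> where \<zeta>: "\<zeta> ^ CARD('p) = \<xi>"
    using nth_root_exists by blast
  have "\<xi> \<noteq> 0" using pow by (auto simp: power_0_left)
  then have nz: "\<zeta> \<noteq> 0" using \<zeta> by (auto simp: power_0_left)
  \<comment> \<open>The exponent is a product of integer representatives, not of residues. Each
    carry in one of its factors then costs a multiple of p in the exponent, and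
    \<open>\<zeta>\<close> to the power p is \<open>\<xi>\<close>.\<close>
  define K where "K u v = inverse (\<zeta> ^ (?N (f u) * ?N (g v)))" for u v
  have K_nz: "K u v \<noteq> 0" for u v using nz by (simp add: K_def)
  have "char_pow \<xi> (f u * carry (g v) (g w) - carry (f u) (f v) * g w) = coboundary2 K u v w"
    for u v w
  proof -
    obtain c where c: "carry (f u) (f v) = (of_nat c :: 'p mod_ring)"
      "int CARD('p) * int c = to_int_mod_ring (f u) + to_int_mod_ring (f v) - to_int_mod_ring (f u + f v)"
      by (rule carry_eq_of_nat)
    obtain d where d: "carry (g v) (g w) = (of_nat d :: 'p mod_ring)"
      "int CARD('p) * int d = to_int_mod_ring (g v) + to_int_mod_ring (g w) - to_int_mod_ring (g v + g w)"
      by (rule carry_eq_of_nat)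
    have N: "int (?N x) = to_int_mod_ring x" for x
      using to_int_mod_ring_bounds(1)[of x] by simp
    have of_N: "of_nat (?N x) = x" for x
      by (metis N of_int_of_nat_eq of_int_to_int_mod_ring)
    have "int (?N (f u + f v) + CARD('p) * c) = int (?N (f u) + ?N (f v))"
      using c(2) by (simp only: of_nat_add of_nat_mult N)
    then have Nf: "?N (f u + f v) + CARD('p) * c = ?N (f u) + ?N (f v)"
      by (simp only: of_nat_eq_iff)
    have "int (?N (g v + g w) + CARD('p) * d) = int (?N (g v) + ?N (g w))"
      using d(2) by (simp only: of_nat_add of_nat_mult N)
    then have Ng: "?N (g v + g w) + CARD('p) * d = ?N (g v) + ?N (g w)"
      by (simp only: of_nat_eq_iff)
    \<comment> \<open>The coboundary identity for the exponents, with terms distributed so that no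
      subtraction of natural numbers occurs.\<close>
    have "?N (f v) * ?N (g w) + ?N (f u) * ?N (g v + g w) + CARD('p) * (?N (f u) * d)
      = ?N (f v) * ?N (g w) + ?N (f u) * (?N (g v + g w) + CARD('p) * d)"
      by (simp add: algebra_simps)
    also have "\<dots> = (?N (f u) + ?N (f v)) * ?N (g w) + ?N (f u) * ?N (g v)"
      unfolding Ng by (simp add: algebra_simps)
    also have "\<dots> = ?N (f u + f v) * ?N (g w) + ?N (f u) * ?N (g v) + CARD('p) * (c * ?N (g w))"
      unfolding Nf[symmetric] by (simp add: algebra_simps)
    finally have eq: "?N (f v) * ?N (g w) + ?N (f u) * ?N (g v + g w) + CARD('p) * (?N (f u) * d)
      = ?N (f u + f v) * ?N (g w) + ?N (f u) * ?N (g v) + CARD('p) * (c * ?N (g w))" .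
    have "\<zeta> ^ (?N (f v) * ?N (g w)) * \<zeta> ^ (?N (f u) * ?N (g v + g w)) * \<xi> ^ (?N (f u) * d)
      = \<zeta> ^ (?N (f u + f v) * ?N (g w)) * \<zeta> ^ (?N (f u) * ?N (g v)) * \<xi> ^ (c * ?N (g w))"
      unfolding \<zeta>[symmetric] power_mult[symmetric] power_add[symmetric] eq ..
    moreover have "char_pow \<xi> (f u * carry (g v) (g w)) = \<xi> ^ (?N (f u) * d)"
      by (metis char_pow_of_nat[OF pow] of_nat_mult of_N d(1))
    moreover have "char_pow \<xi> (carry (f u) (f v) * g w) = \<xi> ^ (c * ?N (g w))"
      by (metis char_pow_of_nat[OF pow] of_nat_mult of_N c(1))
    ultimately show ?thesis
      using nz \<open>\<xi> \<noteq> 0\<close>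
      by (simp add: char_pow_diff[OF pow] coboundary2_def K_def f g divide_simps mult_ac)
  qed
  then have "(\<lambda>u v w. char_pow \<xi> (f u * carry (g v) (g w) - carry (f u) (f v) * g w)) = coboundary2 K"
    by (simp add: fun_eq_iff)
  then show ?thesis
    unfolding null_exponent_def coboundaries3_def using K_nz by blast
qed

text \<open>The Bockstein relation moves the carry from \<open>g\<close> to \<open>f\<close>, and
  commutativity of the cup product brings \<open>g\<close> to the front. This symmetry makes z_0 z_1
  a well-defined element of the symmetric square.\<close>

lemma null_exponent_carry_symmetric:
  fixes \<xi> :: "'k::alg_closed_field" and f g :: "'v::ab_group_add \<Rightarrow> 'p::prime_card mod_ring"
  assumes \<xi>: "primitive_root_of_unity CARD('p) \<xi>"
    and f: "\<And>x y. f (x + y) = f x + f y" and g: "\<And>x y. g (x + y) = g x + g y"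
  shows "null_exponent \<xi> (\<lambda>u v w. f u * carry (g v) (g w) - g u * carry (f v) (f w))"
proof -
  have "null_exponent \<xi> (\<lambda>u v w. carry (f u) (f v) * g w - g u * carry (f v) (f w))"
    by (rule null_exponent_cup_commute[OF \<xi>, where c = "\<lambda>u v. carry (f u) (f v)"])
      (simp_all add: f g carry_cocycle)
  from null_exponent_add[OF \<xi> null_exponent_bockstein[OF \<xi> f g] this] show ?thesis
    by simp
qed


section \<open>The action of matrices on the cocycles\<close>

definition levi_civita :: "3 \<Rightarrow> 3 \<Rightarrow> 3 \<Rightarrow> 'a::comm_ring_1" where
  "levi_civita i j k =
    (if (i, j, k) \<in> {(0, 1, 2), (1, 2, 0), (2, 0, 1)} then 1
     else if (i, j, k) \<in> {(0, 2, 1), (1, 0, 2), (2, 1, 0)} then - 1 else 0)"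

lemma det_3_levi_civita:
  "det (A::'a::comm_ring_1^3^3) =
    (\<Sum>i\<in>UNIV. \<Sum>j\<in>UNIV. \<Sum>k\<in>UNIV. A$0$i * A$1$j * A$2$k * levi_civita i j k)"
  by (simp add: det_3_from_0 sum_3_from_0 levi_civita_def algebra_simps)

text \<open>Modulo null exponents, the adjacent swaps \<open>R\<close> and \<open>L\<close> change
  the sign of a monomial. They generate all permutations, and for odd p a monomial with a repeated
  index vanishes because 2 is invertible.\<close>

lemma null_exponent_monomial:
  fixes \<xi> :: "'k::field"
  assumes odd: "odd CARD('p::prime_card)" and \<xi>: "primitive_root_of_unity CARD('p) \<xi>"
  shows "null_exponent \<xi> (\<lambda>u v w :: 'p mod_ring ^ 3.
    u$i * v$j * w$k - levi_civita i j k * (u$0 * v$1 * w$2))"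
proof -
  note diff = null_exponent_diff[OF \<xi>]
  have R: "null_exponent \<xi> (\<lambda>u v w :: 'p mod_ring ^ 3. u$i * v$j * w$k + u$i * v$k * w$j)" for i j k
    by (rule null_exponent_symmetrize_right[OF \<xi>]) simp_all
  have L: "null_exponent \<xi> (\<lambda>u v w :: 'p mod_ring ^ 3. u$i * v$j * w$k + u$j * v$i * w$k)" for i j k
    by (rule null_exponent_symmetrize_left[OF \<xi>]) simp_all
  have half: "inverse 2 * (x + x) = x" for x :: "'p mod_ring"
    using two_neq_0_mod_ring[OF odd] by (simp flip: mult_2 mult.assoc)
  have iij: "null_exponent \<xi> (\<lambda>u v w :: 'p mod_ring ^ 3. u$i * v$i * w$j)" for i j
    using null_exponent_scale[OF \<xi> L[of i i j], of "inverse 2"] unfolding half .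
  have ijj: "null_exponent \<xi> (\<lambda>u v w :: 'p mod_ring ^ 3. u$i * v$j * w$j)" for i j
    using null_exponent_scale[OF \<xi> R[of i j j], of "inverse 2"] unfolding half .
  have iji: "null_exponent \<xi> (\<lambda>u v w :: 'p mod_ring ^ 3. u$i * v$j * w$i)" for i j
    using diff[OF R[of i j i] iij[of i j]] by simp
  have zero: "null_exponent \<xi> (\<lambda>u v w :: 'p mod_ring ^ 3. u$0 * v$1 * w$2 - u$0 * v$1 * w$2)"
    using null_exponent_0[OF \<xi>] by simp
  consider "i = j" | "j = k" | "i = k" | "(i, j, k) = (0, 1, 2)" | "(i, j, k) = (1, 2, 0)"
    | "(i, j, k) = (2, 0, 1)" | "(i, j, k) = (0, 2, 1)" | "(i, j, k) = (1, 0, 2)"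
    | "(i, j, k) = (2, 1, 0)"
  proof -
    have "x = 0 \<or> x = 1 \<or> x = 2" for x :: 3
      using UNIV_3_from_0 by auto
    from this[of i] this[of j] this[of k] that show thesis by auto
  qed
  then show ?thesis
  proof cases
    case 5
    then show ?thesis
      using diff[OF R[of 1 2 0] L[of 1 0 2]] by (simp add: levi_civita_def)
  next
    case 6
    then show ?thesis
      using diff[OF L[of 2 0 1] R[of 0 2 1]] by (simp add: levi_civita_def)
  next
    case 9
    then show ?thesis
      \<comment> \<open>The reversal of \<open>0, 1, 2\<close> takes three adjacent swaps.\<close>
      using diff[OF R[of 2 1 0] diff[OF L[of 2 0 1] R[of 0 2 1]]] by (simp add: levi_civita_def)
  qed (use iij ijj iji zero R[of 0 2 1] L[of 1 0 2] in \<open>auto simp: levi_civita_def\<close>)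
qed

lemma null_exponent_det:
  fixes \<xi> :: "'k::field" and A :: "'p::prime_card mod_ring ^ 3 ^ 3"
  assumes odd: "odd CARD('p)" and \<xi>: "primitive_root_of_unity CARD('p) \<xi>"
  shows "null_exponent \<xi> (\<lambda>u v w.
    (A *v u)$0 * (A *v v)$1 * (A *v w)$2 - det A * (u$0 * v$1 * w$2))"
proof -
  have "null_exponent \<xi> (\<lambda>u v w :: 'p mod_ring ^ 3. \<Sum>i\<in>UNIV. \<Sum>j\<in>UNIV. \<Sum>k\<in>UNIV.
      A$0$i * A$1$j * A$2$k * (u$i * v$j * w$k - levi_civita i j k * (u$0 * v$1 * w$2)))"
    by (intro null_exponent_sum[OF \<xi>] null_exponent_scale[OF \<xi>] null_exponent_monomial[OF odd \<xi>])
  moreover have "(\<Sum>i\<in>UNIV. \<Sum>j\<in>UNIV. \<Sum>k\<in>UNIV.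
      A$0$i * A$1$j * A$2$k * (u$i * v$j * w$k - levi_civita i j k * (u$0 * v$1 * w$2)))
    = (A *v u)$0 * (A *v v)$1 * (A *v w)$2 - det A * (u$0 * v$1 * w$2)" for u v w
    unfolding det_3_levi_civita matrix_vector_mult_3 right_diff_distrib sum_subtractf sum_distrib_right
    by (simp add: sum_3_from_0 algebra_simps)
  ultimately show ?thesis by simp
qed

text \<open>The first factor is linear outright. The carry is linear only up to the coboundary of
  \<open>h\<close>, whose product with a linear form is null.\<close>

lemma null_exponent_sym_cocycle_linear:
  fixes \<xi> :: "'k::field" and A :: "'p::prime_card mod_ring ^ 'n ^ 'm"
  assumes \<xi>: "primitive_root_of_unity CARD('p) \<xi>"
  shows "null_exponent \<xi> (\<lambda>u v w. (\<Sum>r\<in>UNIV. \<Sum>s\<in>UNIV. A$i$r * A$j$s * (u$r * carry (v$s) (w$s)))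
    - (A *v u)$i * carry ((A *v v)$j) ((A *v w)$j))"
proof -
  obtain h where h: "\<And>v w. (\<Sum>s\<in>UNIV. A$j$s * carry (v$s) (w$s))
      = carry ((A *v v)$j) ((A *v w)$j) + (h v + h w - h (v + w))"
    using carry_linear_combination[where x = "\<lambda>v s. v$s" and I = UNIV and a = "\<lambda>s. A$j$s"]
    by (auto simp: matrix_vector_mult_def)
  have "(\<Sum>r\<in>UNIV. \<Sum>s\<in>UNIV. A$i$r * A$j$s * (u$r * carry (v$s) (w$s)))
      = (A *v u)$i * (\<Sum>s\<in>UNIV. A$j$s * carry (v$s) (w$s))" for u v w
    by (simp add: matrix_vector_mult_def sum_product mult_ac)
  then have "(\<Sum>r\<in>UNIV. \<Sum>s\<in>UNIV. A$i$r * A$j$s * (u$r * carry (v$s) (w$s)))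
      - (A *v u)$i * carry ((A *v v)$j) ((A *v w)$j) = (A *v u)$i * (h v + h w - h (v + w))" for u v w
    by (simp add: h algebra_simps)
  moreover have "null_exponent \<xi> (\<lambda>u v w. (A *v u)$i * (h v + h w - h (v + w)))"
    by (rule null_exponent_cup_coboundary[OF \<xi>]) (simp add: matrix_vector_right_distrib)
  ultimately show ?thesis by simp
qed

text \<open>Basis vectors and sums of two of them read off all coefficients of the quadratic
  form.\<close>

lemma split_form_coefficients:
  fixes A :: "'a::field ^ 3 ^ 3"
  assumes "\<And>u. (A *v u)$0 * (A *v u)$1 = u$0 * u$1"
  shows "A$0$0 * A$1$0 = 0" "A$0$1 * A$1$1 = 0" "A$0$0 * A$1$1 + A$0$1 * A$1$0 = 1"
    "A$0$2 = 0" "A$1$2 = 0"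
proof -
  note eqs = assms[unfolded matrix_vector_mult_3]
  show 00: "A$0$0 * A$1$0 = 0"
    using eqs[of "\<chi> i. if i = 0 then 1 else 0"] by simp
  show 11: "A$0$1 * A$1$1 = 0"
    using eqs[of "\<chi> i. if i = 1 then 1 else 0"] by simp
  have 22: "A$0$2 * A$1$2 = 0"
    using eqs[of "\<chi> i. if i = 2 then 1 else 0"] by simp
  show 01: "A$0$0 * A$1$1 + A$0$1 * A$1$0 = 1"
    using eqs[of "\<chi> i. if i = 2 then 0 else 1"] 00 11 by (simp add: distrib_left distrib_right add.commute)
  have 02: "A$0$0 * A$1$2 + A$0$2 * A$1$0 = 0"
    using eqs[of "\<chi> i. if i = 1 then 0 else 1"] 00 22 by (simp add: distrib_left distrib_right add.commute)
  have 12: "A$0$1 * A$1$2 + A$0$2 * A$1$1 = 0"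
    using eqs[of "\<chi> i. if i = 0 then 0 else 1"] 11 22 by (simp add: distrib_left distrib_right add.commute)
  \<comment> \<open>By \<open>22\<close> one of the two entries is 0. By \<open>02\<close> and
    \<open>12\<close> the other one annihilates the first two entries of the opposite row, which
    \<open>01\<close> prevents from both being 0.\<close>
  show "A$0$2 = 0" using 01 02 12 22 by auto
  show "A$1$2 = 0" using 01 02 12 22 by auto
qed

text \<open>In the expanded form only the coefficients at (0, 1) and (1, 0) survive, and they add up
  to 1. The class thus changes by a multiple of the symmetry relation for carries.\<close>

lemma null_exponent_split_form:
  fixes \<xi> :: "'k::alg_closed_field" and A :: "'p::prime_card mod_ring ^ 3 ^ 3"
  assumes \<xi>: "primitive_root_of_unity CARD('p) \<xi>"
    and A: "\<And>u. (A *v u)$0 * (A *v u)$1 = u$0 * u$1"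
  shows "null_exponent \<xi> (\<lambda>u v w.
    (A *v u)$0 * carry ((A *v v)$1) ((A *v w)$1) - u$0 * carry (v$1) (w$1))"
proof -
  note coeff = split_form_coefficients[OF A]
  have c: "A$0$0 * A$1$1 = 1 - A$0$1 * A$1$0"
    using coeff(3) by (simp add: algebra_simps)
  let ?S = "\<lambda>u v w :: 'p mod_ring ^ 3. \<Sum>r\<in>UNIV. \<Sum>s\<in>UNIV. A$0$r * A$1$s * (u$r * carry (v$s) (w$s))"
  have S: "?S u v w = u$0 * carry (v$1) (w$1)
      - A$0$1 * A$1$0 * (u$0 * carry (v$1) (w$1) - u$1 * carry (v$0) (w$0))" for u v w
    by (simp add: sum_3_from_0 coeff c) (simp add: algebra_simps)
  have "null_exponent \<xi> (\<lambda>u v w :: 'p mod_ring ^ 3.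
      A$0$1 * A$1$0 * (u$0 * carry (v$1) (w$1) - u$1 * carry (v$0) (w$0)))"
    by (intro null_exponent_scale[OF \<xi>] null_exponent_carry_symmetric[OF \<xi>]) simp_all
  from null_exponent_scale[OF \<xi> null_exponent_add[OF \<xi> this
      null_exponent_sym_cocycle_linear[OF \<xi>, of A 0 1]], of "- 1"]
  show ?thesis unfolding S by (simp add: algebra_simps)
qed

section \<open>Stabilizers\<close>

lemma cohomologous_iff_quotient:
  fixes f g :: "('v::ab_group_add, 'k::field) cochain3"
  assumes f: "f \<in> carrier cocycles3" and g: "g \<in> carrier cocycles3"
  shows "cohomologous f g \<longleftrightarrow> (\<lambda>u v w. f u v w / g u v w) \<in> coboundaries3"
proof
  have nz: "g u v w \<noteq> 0" for u v w
    using g by (simp add: cocycles3_def)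
  have class_g: "cohomology_class g = {\<lambda>u v w. h u v w * g u v w | h. h \<in> coboundaries3}"
    by (auto simp: cohomology_class_def r_coset_def cocycles3_def)
  {
    assume "cohomologous f g"
    then have "f \<in> cohomology_class g"
      using mem_cohomology_class[OF f] by (simp add: cohomologous_def)
    then show "(\<lambda>u v w. f u v w / g u v w) \<in> coboundaries3"
      by (auto simp: class_g nz)
  next
    assume "(\<lambda>u v w. f u v w / g u v w) \<in> coboundaries3"
    then have "(\<lambda>u v w. f u v w / g u v w * g u v w) \<in> cohomology_class g"
      unfolding class_g by (intro CollectI exI[of _ "\<lambda>u v w. f u v w / g u v w"]) simp
    then have "f \<in> cohomology_class g" by (simp add: nz)
    then show "cohomologous f g"
      unfolding cohomologous_def by (rule cohomology_class_eq[OF g])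
  }
qed

lemma Stab_char_pow:
  fixes F :: "'a::comm_ring_1 ^ 'n \<Rightarrow> 'a ^ 'n \<Rightarrow> 'a ^ 'n \<Rightarrow> 'p::prime_card mod_ring"
    and \<xi> :: "'k::field"
  assumes \<xi>: "primitive_root_of_unity CARD('p) \<xi>"
    and F: "(\<lambda>u v w. char_pow \<xi> (F u v w)) \<in> carrier cocycles3"
  shows "Stab (cohomology_class (\<lambda>u v w. char_pow \<xi> (F u v w))) =
    {A \<in> carrier GL. null_exponent \<xi> (\<lambda>u v w. F (A *v u) (A *v v) (A *v w) - F u v w)}"
  unfolding Stab_cohomology_class[OF F] cohomologous_iff_quotient[OF pullback3_in_cocycles3[OF F] F]
  by (simp add: null_exponent_def pullback3_def char_pow_diff[OF root_pow_card[OF \<xi>]])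

section \<open>Representing cocycles of the two classes\<close>

lemma omega_D_eq:
  fixes \<xi> :: "'k::field"
  assumes "primitive_root_of_unity CARD('p::prime_card) \<xi>"
  shows "omega_D \<xi> = cohomology_class (\<lambda>u v w :: 'p mod_ring ^ 3. char_pow \<xi> (u$0 * v$1 * w$2))"
proof -
  have "wedge_class \<xi> 0 1 2 \<in> carrier (H3 :: ('p mod_ring ^ 3, 'k) cochain3 set monoid)"
    unfolding wedge_class_def by (intro cohomology_class_in_H3 wedge_cocycle_in_cocycles3 assms)
  then have "omega_D \<xi> = (wedge_class \<xi> 0 1 2 :: ('p mod_ring ^ 3, 'k) cochain3 set)"
    unfolding omega_D_def by (intro monoid.r_one group.is_monoid group_H3)
  then show ?thesis by (simp add: wedge_class_def wedge_cocycle_def)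
qed

lemma omega_Q_eq:
  fixes \<xi> :: "'k::field"
  assumes \<xi>: "primitive_root_of_unity CARD('p::prime_card) \<xi>"
  shows "omega_Q \<xi> = cohomology_class (\<lambda>u v w :: 'p mod_ring ^ 3.
      char_pow \<xi> (u$0 * v$1 * w$2 + u$0 * carry (v$1) (w$1)))"
    and "(\<lambda>u v w :: 'p mod_ring ^ 3. char_pow \<xi> (u$0 * v$1 * w$2 + u$0 * carry (v$1) (w$1)))
      \<in> carrier cocycles3"
proof -
  let ?w = "wedge_cocycle \<xi> 0 1 2 :: ('p mod_ring ^ 3, 'k) cochain3"
  let ?s = "sym_cocycle \<xi> 0 1 :: ('p mod_ring ^ 3, 'k) cochain3"
  note cocycles = wedge_cocycle_in_cocycles3[OF \<xi>, of 0 1 2] sym_cocycle_in_cocycles3[OF \<xi>, of 0 1]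
  have mult: "?w \<otimes>\<^bsub>cocycles3\<^esub> ?s =
      (\<lambda>u v w. char_pow \<xi> (u$0 * v$1 * w$2 + u$0 * carry (v$1) (w$1)))"
    by (simp add: cocycles3_def wedge_cocycle_def sym_cocycle_def char_pow_add[OF root_pow_card[OF \<xi>]])
  have "cohomology_class ?w \<otimes>\<^bsub>H3\<^esub> cohomology_class ?s = cohomology_class (?w \<otimes>\<^bsub>cocycles3\<^esub> ?s)"
    using normal.rcos_sum[OF normal_coboundaries3 cocycles]
    by (simp add: H3_def FactGroup_def cohomology_class_def)
  then show "omega_Q \<xi> = cohomology_class (\<lambda>u v w :: 'p mod_ring ^ 3.
      char_pow \<xi> (u$0 * v$1 * w$2 + u$0 * carry (v$1) (w$1)))"
    unfolding mult by (simp add: omega_Q_def wedge_class_def sym_class_def)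
  have "group (cocycles3 :: ('p mod_ring ^ 3, 'k) cochain3 monoid)"
    by (rule comm_group.axioms(2)[OF comm_group_cocycles3])
  from monoid.m_closed[OF group.is_monoid[OF this] cocycles]
  show "(\<lambda>u v w :: 'p mod_ring ^ 3. char_pow \<xi> (u$0 * v$1 * w$2 + u$0 * carry (v$1) (w$1)))
      \<in> carrier cocycles3"
    unfolding mult .
qed


text \<open>Evaluates the telescoping invariant of \<open>omega_Q\<close> at a vector with
  coordinates \<open>a\<close>, \<open>b\<close>, \<open>c\<close>: the trilinear part is
  proportional to m and cancels for odd p.\<close>

lemma sum_cyclic_quadratic:
  fixes a b c :: "'p::prime_card mod_ring"
  assumes "odd CARD('p)"
  shows "(\<Sum>m<CARD('p). a * (of_nat m * b) * c + a * carry (of_nat m * b) b) = a * b"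
proof -
  have "(\<Sum>m<CARD('p). a * (of_nat m * b) * c + a * carry (of_nat m * b) b)
    = a * b * c * (\<Sum>m<CARD('p). of_nat m) + a * (\<Sum>m<CARD('p). carry (of_nat m * b) b)"
    by (simp add: sum.distrib sum_distrib_left mult_ac)
  then show ?thesis
    by (simp add: sum_of_nat_mod_ring_eq_0[OF assms] sum_carry_multiples)
qed

text \<open>Antisymmetrization kills the terms symmetric in two variables and sees only the
  determinant.\<close>

lemma det_eq_1_if_null_exponent:
  fixes \<xi> :: "'k::field" and A :: "'p::prime_card mod_ring ^ 3 ^ 3"
  assumes \<xi>: "primitive_root_of_unity CARD('p) \<xi>"
    and null: "null_exponent \<xi> (\<lambda>u v w.
      (A *v u)$0 * (A *v v)$1 * (A *v w)$2 - u$0 * v$1 * w$2 + S u v w)"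
    and S: "\<And>u v w. S u v w = S u w v"
  shows "det A = 1"
proof -
  define e :: "3 \<Rightarrow> 'p mod_ring ^ 3" where "e j = (\<chi> i. if i = j then 1 else 0)" for j
  have A: "(A *v e j) $ i = A$i$j" for i j
    by (simp add: e_def matrix_vector_mult_def if_distrib cong: if_cong)
  have e: "e j $ i = (if i = j then 1 else 0)" for i j
    by (simp add: e_def)
  show ?thesis
    using null_exponent_alternating[OF \<xi> null, of "e 0" "e 1" "e 2"]
      S[of "e 0" "e 1" "e 2"] S[of "e 1" "e 2" "e 0"] S[of "e 2" "e 0" "e 1"]
    unfolding A e det_3_from_0 by (simp add: algebra_simps)
qed

section \<open>The two stabilizers as matrix groups\<close>

lemma Stab_omega_D:
  fixes \<xi> :: "'k::field"
  assumes odd: "odd CARD('p::prime_card)" and \<xi>: "primitive_root_of_unity CARD('p) \<xi>"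
  shows "Stab (omega_D \<xi> :: ('p mod_ring ^ 3, 'k) cochain3 set) = SL"
proof -
  have "(\<lambda>u v w :: 'p mod_ring ^ 3. char_pow \<xi> (u$0 * v$1 * w$2)) \<in> carrier cocycles3"
    using wedge_cocycle_in_cocycles3[OF \<xi>, of 0 1 2] by (simp add: wedge_cocycle_def)
  note Stab = Stab_char_pow[OF \<xi> this]
  have "null_exponent \<xi> (\<lambda>u v w. (A *v u)$0 * (A *v v)$1 * (A *v w)$2 - u$0 * v$1 * w$2) \<longleftrightarrow> det A = 1"
    for A :: "'p mod_ring ^ 3 ^ 3"
    using null_exponent_det[OF odd \<xi>, of A] det_eq_1_if_null_exponent[OF \<xi>, of A "\<lambda>_ _ _. 0"]
    by auto
  then show ?thesis
    unfolding omega_D_eq[OF \<xi>] Stab by (simp add: SL_def)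
qed

lemma Stab_omega_Q:
  fixes \<xi> :: "'k::alg_closed_field"
  assumes odd: "odd CARD('p::prime_card)" and \<xi>: "primitive_root_of_unity CARD('p) \<xi>"
  shows "Stab (omega_Q \<xi> :: ('p mod_ring ^ 3, 'k) cochain3 set) =
    {A. det A = 1 \<and> (\<forall>u. (A *v u)$0 * (A *v u)$1 = u$0 * u$1)}"
proof -
  have "null_exponent \<xi> (\<lambda>u v w.
        (A *v u)$0 * (A *v v)$1 * (A *v w)$2 + (A *v u)$0 * carry ((A *v v)$1) ((A *v w)$1)
        - (u$0 * v$1 * w$2 + u$0 * carry (v$1) (w$1)))
      \<longleftrightarrow> det A = 1 \<and> (\<forall>u. (A *v u)$0 * (A *v u)$1 = u$0 * u$1)" (is "?null \<longleftrightarrow> ?inv")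
    for A :: "'p mod_ring ^ 3 ^ 3"
  proof
    assume ?null
    then have null: "null_exponent \<xi> (\<lambda>u v w.
        (A *v u)$0 * (A *v v)$1 * (A *v w)$2 - u$0 * v$1 * w$2
        + ((A *v u)$0 * carry ((A *v v)$1) ((A *v w)$1) - u$0 * carry (v$1) (w$1)))"
      by (simp add: algebra_simps)
    have "det A = 1"
      by (rule det_eq_1_if_null_exponent[OF \<xi> null]) (simp add: carry_commute)
    moreover have "(A *v u)$0 * (A *v u)$1 = u$0 * u$1" for u
      \<comment> \<open>The cyclic sum of the difference is the form at \<open>A *v u\<close> minus
        the form at \<open>u\<close>.\<close>
      using null_exponent_sum_cyclic[OF \<xi> \<open>?null\<close>, of u]
      unfolding sum_subtractf vector_scalar_commute vector_smult_component
        sum_cyclic_quadratic[OF odd] by simp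
    ultimately show ?inv by blast
  next
    assume ?inv
    then have "null_exponent \<xi> (\<lambda>u v w. (A *v u)$0 * (A *v v)$1 * (A *v w)$2 - u$0 * v$1 * w$2)"
      using null_exponent_det[OF odd \<xi>, of A] by simp
    from null_exponent_add[OF \<xi> this null_exponent_split_form[OF \<xi>, of A]] \<open>?inv\<close> show ?null
      by (simp add: algebra_simps)
  qed
  moreover have "A \<in> carrier GL" if "det A = 1" for A :: "'p mod_ring ^ 3 ^ 3"
    using that by (simp add: GL_def invertible_det_nz)
  ultimately show ?thesis
    unfolding omega_Q_eq(1)[OF \<xi>] Stab_char_pow[OF \<xi> omega_Q_eq(2)[OF \<xi>]] by auto
qed

section \<open>The affine orthogonal group as a matrix group\<close>

text \<open>In the coordinates \<open>(x, z)\<close> of \<open>F\<^sup>2 \<times> F\<close>, the matrix of \<open>(x, z) \<mapsto> (B x, det B z - det (a | B x))\<close>.\<close>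

definition affine_to_linear :: "('a::comm_ring_1 ^ 2) \<times> ('a ^ 2 ^ 2) \<Rightarrow> 'a ^ 3 ^ 3" where
  "affine_to_linear = (\<lambda>(a, B). \<chi> i j.
    if i = 0 then (if j = 0 then B$0$0 else if j = 1 then B$0$1 else 0)
    else if i = 1 then (if j = 0 then B$1$0 else if j = 1 then B$1$1 else 0)
    else if j = 0 then a$1 * B$0$0 - a$0 * B$1$0
    else if j = 1 then a$1 * B$0$1 - a$0 * B$1$1
    else det B)"

text \<open>The inverse of \<open>affine_to_linear\<close> on the stabilizer: Cramer's rule recovers
  the translation from the last row, and the entry \<open>A$2$2\<close>, there equal to
  \<open>det B\<close>, is its own inverse.\<close>

definition linear_to_affine :: "'a::comm_ring_1 ^ 3 ^ 3 \<Rightarrow> ('a ^ 2) \<times> ('a ^ 2 ^ 2)" where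
  "linear_to_affine A =
    ((\<chi> i. A$2$2 * (if i = 0 then A$2$0 * A$0$1 - A$2$1 * A$0$0 else A$2$0 * A$1$1 - A$2$1 * A$1$0)),
     (\<chi> i j. A $ (if i = 0 then 0 else 1) $ (if j = 0 then 0 else 1)))"

lemma forall_2_from_0: "(\<forall>i::2. P i) \<longleftrightarrow> P 0 \<and> P 1"
  using UNIV_2_from_0 by (metis UNIV_I empty_iff insert_iff)

lemma forall_3_from_0: "(\<forall>i::3. P i) \<longleftrightarrow> P 0 \<and> P 1 \<and> P 2"
  using UNIV_3_from_0 by (metis UNIV_I empty_iff insert_iff)

text \<open>Behind the calculation is det (B a' | B y) = det B det (a' | y), together with the
  additivity of det (a | y) in a.\<close>

lemma affine_to_linear_mult:
  "affine_to_linear (a + B *v a', B ** B') = affine_to_linear (a, B) ** affine_to_linear (a', B')"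
  by (simp add: vec_eq_iff forall_3_from_0 matrix_matrix_mult_def sum_3_from_0 sum_2_from_0
      affine_to_linear_def matrix_vector_mult_2 det_2_from_0 algebra_simps)

lemma det_affine_to_linear: "det (affine_to_linear (a, B)) = (det B)\<^sup>2"
  by (simp add: det_3_from_0 affine_to_linear_def det_2_from_0 power2_eq_square algebra_simps)

text \<open>Discriminant identity. It shows that orthogonal matrices have a determinant of square 1,
  as needed for \<open>affine_to_linear\<close> to have determinant 1.\<close>

lemma det_squared_eq_1_if_split_form:
  fixes a b c d :: "'a::comm_ring_1"
  assumes "a * c = 0" "b * d = 0" "a * d + b * c = 1"
  shows "(a * d - b * c)\<^sup>2 = 1"
proof -
  have "(a * d - b * c)\<^sup>2 = (a * d + b * c)\<^sup>2 - 4 * (a * c) * (b * d)"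
    by (simp add: power2_eq_square algebra_simps)
  then show ?thesis by (simp add: assms)
qed

lemma O2_coefficients:
  fixes B :: "'a::field ^ 2 ^ 2"
  assumes "B \<in> O2"
  shows "B$0$0 * B$1$0 = 0" "B$0$1 * B$1$1 = 0" "B$0$0 * B$1$1 + B$0$1 * B$1$0 = 1"
proof -
  have eqs: "(B$0$0 * u$0 + B$0$1 * u$1) * (B$1$0 * u$0 + B$1$1 * u$1) = u$0 * u$1"
    for u :: "'a ^ 2"
    using assms by (simp add: O2_def split_form_def matrix_vector_mult_2)
  show 00: "B$0$0 * B$1$0 = 0"
    using eqs[of "\<chi> i. if i = 0 then 1 else 0"] by simp
  show 11: "B$0$1 * B$1$1 = 0"
    using eqs[of "\<chi> i. if i = 1 then 1 else 0"] by simp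
  show "B$0$0 * B$1$1 + B$0$1 * B$1$0 = 1"
    using eqs[of "\<chi> i. 1"] 00 11 by (simp add: distrib_left distrib_right add.commute)
qed

lemma O2_mult: "A ** B \<in> O2" if "A \<in> O2" "B \<in> O2"
  using that by (simp add: O2_def GL_def invertible_mult flip: matrix_vector_mul_assoc)

lemma affine_group_O2_iso:
  fixes S :: "('a::field ^ 3 ^ 3) set"
  defines "S \<equiv> {A. det A = 1 \<and> (\<forall>u. (A *v u)$0 * (A *v u)$1 = u$0 * u$1)}"
  shows "GL\<lparr>carrier := S\<rparr> \<cong> affine_group (O2 :: ('a ^ 2 ^ 2) set)"
proof -
  let ?to = "affine_to_linear :: ('a ^ 2) \<times> ('a ^ 2 ^ 2) \<Rightarrow> 'a ^ 3 ^ 3"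
  let ?of = "linear_to_affine :: 'a ^ 3 ^ 3 \<Rightarrow> ('a ^ 2) \<times> ('a ^ 2 ^ 2)"
  have to_S: "?to (a, B) \<in> S" and of_to: "?of (?to (a, B)) = (a, B)" if B: "B \<in> O2" for a B
  proof -
    have det: "(det B)\<^sup>2 = 1"
      unfolding det_2_from_0 by (rule det_squared_eq_1_if_split_form[OF O2_coefficients[OF B]])
    have "(?to (a, B) *v u)$0 * (?to (a, B) *v u)$1 = u$0 * u$1" for u
    proof -
      have "split_form (B *v (\<chi> i. if i = 0 then u$0 else u$1)) = u$0 * u$1"
        using B by (simp add: O2_def split_form_def)
      then show ?thesis
        by (simp add: split_form_def matrix_vector_mult_2 matrix_vector_mult_3 affine_to_linear_def)
    qed
    then show "?to (a, B) \<in> S"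
      by (simp add: S_def det_affine_to_linear det)
    have "det B * ((a$1 * B$0$0 - a$0 * B$1$0) * B$0$1 - (a$1 * B$0$1 - a$0 * B$1$1) * B$0$0)
        = (det B)\<^sup>2 * a$0"
      "det B * ((a$1 * B$0$0 - a$0 * B$1$0) * B$1$1 - (a$1 * B$0$1 - a$0 * B$1$1) * B$1$0)
        = (det B)\<^sup>2 * a$1"
      by (simp_all add: det_2_from_0 power2_eq_square algebra_simps)
    then show "?of (?to (a, B)) = (a, B)"
      by (simp add: linear_to_affine_def affine_to_linear_def vec_eq_iff forall_2_from_0 det)
  qed
  have of_O2: "snd (?of A) \<in> O2" and to_of: "?to (?of A) = A" if A: "A \<in> S" for A
  proof -
    have form: "(A *v u)$0 * (A *v u)$1 = u$0 * u$1" for u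
      using A by (simp add: S_def)
    note coeff = split_form_coefficients[OF form]
    let ?d = "A$0$0 * A$1$1 - A$0$1 * A$1$0"
    have d: "?d\<^sup>2 = 1"
      by (rule det_squared_eq_1_if_split_form[OF coeff(1-3)])
    have det_A: "?d * A$2$2 = 1"
      using A by (simp add: S_def det_3_from_0 coeff algebra_simps)
    have "A$2$2 = ?d\<^sup>2 * A$2$2"
      unfolding d by simp
    also have "\<dots> = ?d"
      unfolding power2_eq_square mult.assoc[of ?d ?d] det_A by simp
    finally have A22: "A$2$2 = ?d" .
    have det: "det (snd (?of A)) = ?d"
      by (simp add: linear_to_affine_def det_2_from_0)
    have "?d \<noteq> 0" using d by auto
    then have "invertible (snd (?of A))"
      by (simp add: invertible_det_nz det)
    moreover have "split_form (snd (?of A) *v u) = split_form u" for u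
      using form[of "\<chi> i. if i = 0 then u$0 else if i = 1 then u$1 else 0"]
      by (simp add: split_form_def matrix_vector_mult_2 matrix_vector_mult_3 linear_to_affine_def)
    ultimately show "snd (?of A) \<in> O2"
      by (simp add: O2_def GL_def)
    \<comment> \<open>Cramer's rule in the other direction: rebuilding the last row from the
      recovered translation multiplies it by \<open>?d\<close> squared, which is 1.\<close>
    have "?d * (A$2$0 * A$1$1 - A$2$1 * A$1$0) * A$0$0 - ?d * (A$2$0 * A$0$1 - A$2$1 * A$0$0) * A$1$0
        = ?d\<^sup>2 * A$2$0"
      "?d * (A$2$0 * A$1$1 - A$2$1 * A$1$0) * A$0$1 - ?d * (A$2$0 * A$0$1 - A$2$1 * A$0$0) * A$1$1
        = ?d\<^sup>2 * A$2$1"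
      by (simp_all add: power2_eq_square algebra_simps)
    then have row: "A$2$2 * (A$2$0 * A$1$1 - A$2$1 * A$1$0) * A$0$0
          - A$2$2 * (A$2$0 * A$0$1 - A$2$1 * A$0$0) * A$1$0 = A$2$0"
      "A$2$2 * (A$2$0 * A$1$1 - A$2$1 * A$1$0) * A$0$1
          - A$2$2 * (A$2$0 * A$0$1 - A$2$1 * A$0$0) * A$1$1 = A$2$1"
      unfolding d A22 by (simp_all only: mult_1_left)
    have "?to (?of A) $ i $ j = A $ i $ j" for i j
    proof -
      consider "i = 0" | "i = 1" | "i = 2" "j = 0" | "i = 2" "j = 1" | "i = 2" "j = 2"
        using UNIV_3_from_0 by blast
      then show ?thesis
      proof cases
        case 3
        then show ?thesis using row(1) by (simp add: affine_to_linear_def linear_to_affine_def)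
      next
        case 4
        then show ?thesis using row(2) by (simp add: affine_to_linear_def linear_to_affine_def)
      next
        case 5
        then show ?thesis using A22 det by (simp add: affine_to_linear_def linear_to_affine_def)
      qed (use coeff(4,5) UNIV_3_from_0 in
          \<open>auto simp: affine_to_linear_def linear_to_affine_def\<close>)
    qed
    then show "?to (?of A) = A" by (simp add: vec_eq_iff)
  qed
  have bij: "bij_betw ?of S (UNIV \<times> O2)"
    using to_S of_to of_O2 to_of
    by (intro bij_betw_byWitness[where f' = ?to]) (auto simp: mem_Times_iff image_subset_iff)
  have "?of (A ** A') = (fst (?of A) + snd (?of A) *v fst (?of A'), snd (?of A) ** snd (?of A'))"
    if "A \<in> S" "A' \<in> S" for A A'
  proof -
    \<comment> \<open>Multiplicativity is a polynomial identity for \<open>?to\<close>; applying the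
      inverse transfers it to \<open>?of\<close>.\<close>
    have "A ** A' = ?to (fst (?of A) + snd (?of A) *v fst (?of A'), snd (?of A) ** snd (?of A'))"
      by (simp add: affine_to_linear_mult to_of that)
    then show ?thesis
      by (simp add: of_to O2_mult of_O2 that)
  qed
  with bij have "?of \<in> iso (GL\<lparr>carrier := S\<rparr>) (affine_group O2)"
    using of_O2
    by (simp add: iso_def hom_def affine_group_def GL_def mem_Times_iff Pi_def split_beta)
  then show ?thesis unfolding is_iso_def by blast
qed

theorem proposition6p4:
  fixes \<xi> :: "'k::{alg_closed_field, field_char_0}"
  assumes "odd CARD('p::prime_card)"
    and "primitive_root_of_unity CARD('p) \<xi>"
  shows "Stab (omega_D \<xi> :: ('p mod_ring ^ 3, 'k) cochain3 set) = SL
    \<and> GL\<lparr>carrier := Stab (omega_Q \<xi> :: ('p mod_ring ^ 3, 'k) cochain3 set)\<rparr>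
        \<cong> affine_group (O2 :: ('p mod_ring ^ 2 ^ 2) set)"
  unfolding Stab_omega_D[OF assms] Stab_omega_Q[OF assms] using affine_group_O2_iso by blast

end
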